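(* Let $G=(V,E^+,E^-)$ be a complete signed graph and $F$ a bad triangle cover of $G$. Run the following randomized pivot procedure: initially all vertices are unclustered; while some vertex is unclustered, pick a pivot $u$ uniformly at random among the unclustered vertices, set $P_u=\{u\}$, and for every other unclustered $v$ independently add $v$ to $P_u$ with probability $1$ if $uv\in E^+\setminus F$, $1/4$ if $uv\in E^+\cap F$, $3/4$ if $uv\in E^-\cap F$, and $0$ if $uv\in E^-\setminus F$; then mark all vertices of $P_u$ as clustered and add $P_u$ as a cluster. The resulting clustering has expected number of disagreements at most $\frac{3}{2}|F|$.
   Context: A complete signed graph has every pair of distinct vertices in exactly one of $E^+$ (positive) or $E^-$ (negative). A bad triangle is a triple of vertices with exactly one negative pair; a bad triangle cover is a set $F$ of vertex pairs containing at least one pair of every bad triangle. The number of disagreements (mistakes) of a partition of $V$ is the number of positive edges between different parts plus the number of negative edges within parts. *)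

theory Defs
  imports "HOL-Probability.Probability"
begin

definition vertex_pairs :: "'a set \<Rightarrow> 'a set set" where
  "vertex_pairs V = {e. e \<subseteq> V \<and> card e = 2}"

definition complete_signed_graph :: "'a set \<Rightarrow> 'a set set \<Rightarrow> 'a set set \<Rightarrow> bool" where
  "complete_signed_graph V Ep En \<longleftrightarrow>
     finite V \<and> Ep \<union> En = vertex_pairs V \<and> Ep \<inter> En = {}"

definition bad_triangle :: "'a set \<Rightarrow> 'a set set \<Rightarrow> 'a set \<Rightarrow> bool" where
  "bad_triangle V En T \<longleftrightarrow> T \<subseteq> V \<and> card T = 3 \<and> card {e \<in> En. e \<subseteq> T} = 1"

definition bad_triangle_cover :: "'a set \<Rightarrow> 'a set set \<Rightarrow> 'a set set \<Rightarrow> bool" where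
  "bad_triangle_cover V En F \<longleftrightarrow>
     F \<subseteq> vertex_pairs V \<and> (\<forall>T. bad_triangle V En T \<longrightarrow> (\<exists>e\<in>F. e \<subseteq> T))"

definition disagreements :: "'a set set \<Rightarrow> 'a set set \<Rightarrow> 'a set set \<Rightarrow> nat" where
  "disagreements Ep En P =
     card {e \<in> Ep. \<exists>A\<in>P. \<exists>B\<in>P. A \<noteq> B \<and> (\<exists>u\<in>A. \<exists>v\<in>B. e = {u, v})} +
     card {e \<in> En. \<exists>A\<in>P. e \<subseteq> A}"

definition join_prob :: "'a set set \<Rightarrow> 'a set set \<Rightarrow> 'a set set \<Rightarrow> 'a set \<Rightarrow> real" where
  "join_prob Ep En F e =
     (if e \<in> Ep - F then 1
      else if e \<in> Ep \<inter> F then 1 / 4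
      else if e \<in> En \<inter> F then 3 / 4
      else 0)"

text \<open>
  The random cluster of the pivot \<open>u\<close> when \<open>U\<close> is the set of unclustered vertices. The product
  distribution makes the decisions for the vertices of \<open>U - {u}\<close> independent.
\<close>
definition pivot_cluster ::
    "'a set set \<Rightarrow> 'a set set \<Rightarrow> 'a set set \<Rightarrow> 'a set \<Rightarrow> 'a \<Rightarrow> 'a set pmf" where
  "pivot_cluster Ep En F U u =
     map_pmf (\<lambda>joins. insert u {v \<in> U - {u}. joins v})
       (Pi_pmf (U - {u}) False (\<lambda>v. bernoulli_pmf (join_prob Ep En F {u, v})))"

text \<open>
  Distribution of the set of clusters produced from the unclustered set \<open>U\<close>. For infinite \<open>U\<close>,
  where there is no uniform choice of a pivot, the value is a dummy.
\<close>
function pivot_clustering ::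
    "'a set set \<Rightarrow> 'a set set \<Rightarrow> 'a set set \<Rightarrow> 'a set \<Rightarrow> 'a set set pmf" where
  "pivot_clustering Ep En F U =
     (if infinite U \<or> U = {} then return_pmf {}
      else bind_pmf (pmf_of_set U) (\<lambda>u.
             bind_pmf (pivot_cluster Ep En F U u) (\<lambda>C.
               map_pmf (insert C) (pivot_clustering Ep En F (U - C)))))"
  by pat_completeness auto
termination
proof (relation "Wellfounded.measure (\<lambda>(_, _, _, U). card U)", simp, goal_cases)
  case (1 Ep En F U u C)
  then have "u \<in> U" "u \<in> C" "finite U"
    by (auto simp: pivot_cluster_def)
  then have "card (U - C) < card U"
    by (intro psubset_card_mono) auto
  then show ?case by simp
qed

text \<open>The recursion equation is unconditional, so it would loop as a rewrite rule.\<close>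
declare pivot_clustering.simps [simp del]

end

theory Submission
  imports Defs
begin

text \<open>
  Compare, round by round, the disagreements created when the cluster \<open>C\<close> is removed from the
  unclustered set \<open>U\<close> with \<open>3/2\<close> times the number of pairs of \<open>F\<close> that leave play. The excess
  is a sum over the pairs \<open>{v, w}\<close> in \<open>U\<close>, so averaging over the pivot \<open>u\<close> gives a sum over triples
  \<open>(u, v, w)\<close>. Grouping the three choices of the pivot inside a triple makes every group nonpositive:
  this is a finite check over the types of the three pairs, in which the only violating configuration
  (two positive pairs and a negative pair, none in \<open>F\<close>) is excluded by the cover property.
\<close>

section \<open>Finitely supported expectations and sums over vertex pairs\<close>

lemma expectation_bind_pmf_finite:
  fixes h :: "'b \<Rightarrow> real"
  assumes "finite (set_pmf p)" and "\<And>x. x \<in> set_pmf p \<Longrightarrow> finite (set_pmf (f x))"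
  shows "measure_pmf.expectation (bind_pmf p f) h =
         measure_pmf.expectation p (\<lambda>x. measure_pmf.expectation (f x) h)"
  using assms
  by (subst pmf_expectation_bind[of "set_pmf p"])
     (auto simp: integral_measure_pmf_real[of "set_pmf p"] mult.commute)

lemma expectation_mono_finite:
  fixes f g :: "'b \<Rightarrow> real"
  assumes "finite (set_pmf p)" and "\<And>x. x \<in> set_pmf p \<Longrightarrow> f x \<le> g x"
  shows "measure_pmf.expectation p f \<le> measure_pmf.expectation p g"
  using assms
  by (intro integral_mono_AE integrable_measure_pmf_finite) (auto simp: AE_measure_pmf_iff)

lemma finite_vertex_pairs: "finite U \<Longrightarrow> finite (vertex_pairs U)"
  by (rule finite_subset[of _ "Pow U"]) (auto simp: vertex_pairs_def)

lemma doubleton_in_vertex_pairs: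
  "v \<in> U \<Longrightarrow> w \<in> U \<Longrightarrow> v \<noteq> w \<Longrightarrow> {v, w} \<in> vertex_pairs U"
  by (auto simp: vertex_pairs_def)

text \<open>Each unordered pair arises from two ordered ones. In the induction, a new vertex
  \<open>x\<close> contributes its pairs once as a row and once as a column. Ordered sums are what
  later allows the three vertices of a triple to be permuted freely.\<close>

lemma sum_ordered_pairs:
  fixes g :: "'a set \<Rightarrow> real"
  assumes "finite U"
  shows "(\<Sum>v\<in>U. \<Sum>w\<in>U. if v = w then 0 else g {v, w}) = 2 * (\<Sum>e\<in>vertex_pairs U. g e)"
  using assms
proof (induction U)
  case empty
  have "vertex_pairs {} = ({} :: 'a set set)"
    by (auto simp: vertex_pairs_def)
  then show ?case by simp
next
  case (insert x U)
  have eq: "vertex_pairs (insert x U) = vertex_pairs U \<union> (\<lambda>y. {x, y}) ` U"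
  proof (intro equalityI subsetI)
    fix e assume e: "e \<in> vertex_pairs (insert x U)"
    then obtain a b where "e = {a, b}" "a \<noteq> b"
      by (auto simp: vertex_pairs_def card_2_iff)
    with e show "e \<in> vertex_pairs U \<union> (\<lambda>y. {x, y}) ` U"
      by (cases "a = x"; cases "b = x") (auto simp: vertex_pairs_def insert_commute)
  qed (use insert.hyps in \<open>auto simp: vertex_pairs_def card_2_iff\<close>)
  have "(\<Sum>e\<in>vertex_pairs (insert x U). g e) =
      (\<Sum>e\<in>vertex_pairs U. g e) + (\<Sum>e\<in>(\<lambda>y. {x, y}) ` U. g e)"
    unfolding eq using insert.hyps
    by (intro sum.union_disjoint) (auto simp: finite_vertex_pairs vertex_pairs_def)
  also have "(\<Sum>e\<in>(\<lambda>y. {x, y}) ` U. g e) = (\<Sum>y\<in>U. g {x, y})"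
    by (subst sum.reindex) (auto simp: inj_on_def doubleton_eq_iff)
  finally have R: "(\<Sum>e\<in>vertex_pairs (insert x U). g e) =
      (\<Sum>e\<in>vertex_pairs U. g e) + (\<Sum>y\<in>U. g {x, y})" .
  have a: "(\<Sum>w\<in>U. if x = w then 0 else g {x, w}) = (\<Sum>y\<in>U. g {x, y})"
    using insert.hyps by (intro sum.cong) auto
  have b: "(\<Sum>v\<in>U. if v = x then 0 else g {v, x}) = (\<Sum>y\<in>U. g {x, y})"
    using insert.hyps by (intro sum.cong) (auto simp: insert_commute)
  show ?case
    using insert.hyps insert.IH by (simp add: sum.distrib a b R)
qed

section \<open>Supports of the random cluster and of the clustering\<close>

lemma set_pmf_pivot_cluster:
  assumes "u \<in> U" and "C \<in> set_pmf (pivot_cluster Ep En F U u)"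
  shows "u \<in> C" and "C \<subseteq> U"
  using assms by (auto simp: pivot_cluster_def)

lemma finite_set_pmf_pivot_cluster:
  assumes "finite U" and "u \<in> U"
  shows "finite (set_pmf (pivot_cluster Ep En F U u))"
proof (rule finite_subset)
  show "set_pmf (pivot_cluster Ep En F U u) \<subseteq> Pow U"
    using set_pmf_pivot_cluster(2)[OF assms(2)] by blast
qed (use assms in simp)

lemma pivot_clustering_step:
  assumes "finite U" and "U \<noteq> {}"
  shows "pivot_clustering Ep En F U =
    bind_pmf (pmf_of_set U) (\<lambda>u. bind_pmf (pivot_cluster Ep En F U u) (\<lambda>C.
      map_pmf (insert C) (pivot_clustering Ep En F (U - C))))"
  using assms by (subst pivot_clustering.simps) (simp only: if_False simp_thms not_not)

lemma set_pmf_pivot_clustering: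
  assumes "finite U" and "P \<in> set_pmf (pivot_clustering Ep En F U)"
  shows "P \<subseteq> Pow U"
  using assms
proof (induction "card U" arbitrary: U P rule: less_induct)
  case less
  show ?case
  proof (cases "U = {}")
    case True
    then show ?thesis
      using less.prems by (simp add: pivot_clustering.simps[of _ _ _ "{}"])
  next
    case False
    from less.prems(2) obtain u C Q where *:
        "u \<in> U" "C \<in> set_pmf (pivot_cluster Ep En F U u)"
        "Q \<in> set_pmf (pivot_clustering Ep En F (U - C))" "P = insert C Q"
      unfolding pivot_clustering_step[OF less.prems(1) False]
      using False less.prems(1) by auto
    note C = set_pmf_pivot_cluster[OF *(1,2)]
    have "card (U - C) < card U"
      using C *(1) less.prems(1) by (intro psubset_card_mono) auto
    then have "Q \<subseteq> Pow (U - C)"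
      using less.hyps[OF _ _ *(3)] less.prems(1) by simp
    with C *(4) show ?thesis by auto
  qed
qed

lemma finite_set_pmf_pivot_clustering:
  assumes "finite U"
  shows "finite (set_pmf (pivot_clustering Ep En F U))"
proof (rule finite_subset)
  show "set_pmf (pivot_clustering Ep En F U) \<subseteq> Pow (Pow U)"
    using set_pmf_pivot_clustering[OF assms] by blast
qed (use assms in simp)

section \<open>Independence of the joining decisions\<close>

lemma join_prob_bounds: "0 \<le> join_prob Ep En F e" "join_prob Ep En F e \<le> 1"
  by (auto simp: join_prob_def)

text \<open>The event is a box in the product space: coordinates in \<open>S\<close> are forced to
  \<open>True\<close>, the others are free, and the pivot belongs to its cluster anyway. Singletons
  \<open>S\<close> give the marginals, doubletons the joint probabilities.\<close>

lemma prob_subset_pivot_cluster: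
  assumes "finite U" and "u \<in> U" and "S \<subseteq> U"
  shows "measure_pmf.prob (pivot_cluster Ep En F U u) {C. S \<subseteq> C} =
         (\<Prod>v\<in>S - {u}. join_prob Ep En F {u, v})"
proof -
  let ?p = "\<lambda>v. bernoulli_pmf (join_prob Ep En F {u, v})"
  have "(\<lambda>joins. insert u {v \<in> U - {u}. joins v}) -` {C. S \<subseteq> C} =
      Pi (U - {u}) (\<lambda>v. if v \<in> S then {True} else UNIV)"
    using assms by (auto simp: Pi_def split: if_splits)
  then have "measure_pmf.prob (pivot_cluster Ep En F U u) {C. S \<subseteq> C} =
      (\<Prod>v\<in>U - {u}. measure_pmf.prob (?p v) (if v \<in> S then {True} else UNIV))"
    using assms by (simp add: pivot_cluster_def measure_Pi_pmf_Pi)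
  also have "\<dots> = (\<Prod>v\<in>U - {u}. if v \<in> S then join_prob Ep En F {u, v} else 1)"
    by (intro prod.cong) (auto simp: measure_pmf_single join_prob_bounds)
  also have "\<dots> = (\<Prod>v\<in>(U - {u}) \<inter> S. join_prob Ep En F {u, v})"
    using assms by (subst prod.inter_restrict) auto
  also have "(U - {u}) \<inter> S = S - {u}"
    using assms by auto
  finally show ?thesis .
qed

definition incidence :: "'a \<Rightarrow> 'a set \<Rightarrow> real" where
  "incidence v C = (if v \<in> C then 1 else 0)"

text \<open>The value 1 at \<open>u = v\<close> records that the pivot always lies in its own
  cluster, so that product formulas also cover pairs containing the pivot.\<close>

definition pivot_prob :: "'a set set \<Rightarrow> 'a set set \<Rightarrow> 'a set set \<Rightarrow> 'a \<Rightarrow> 'a \<Rightarrow> real" where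
  "pivot_prob Ep En F u v = (if u = v then 1 else join_prob Ep En F {u, v})"

lemma expectation_incidence:
  assumes "finite U" and "u \<in> U" and "v \<in> U"
  shows "measure_pmf.expectation (pivot_cluster Ep En F U u) (incidence v) =
         pivot_prob Ep En F u v"
proof -
  have "incidence v = indicat_real {C. {v} \<subseteq> C}"
    by (auto simp: incidence_def indicator_def)
  then have "measure_pmf.expectation (pivot_cluster Ep En F U u) (incidence v) =
      measure_pmf.prob (pivot_cluster Ep En F U u) {C. {v} \<subseteq> C}"
    by simp
  also have "\<dots> = pivot_prob Ep En F u v"
    using assms by (subst prob_subset_pivot_cluster) (auto simp: pivot_prob_def)
  finally show ?thesis .
qed

lemma expectation_incidence_mult:
  assumes "finite U" and "u \<in> U" and "v \<in> U" and "w \<in> U" and "v \<noteq> w"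
  shows "measure_pmf.expectation (pivot_cluster Ep En F U u) (\<lambda>C. incidence v C * incidence w C) =
         pivot_prob Ep En F u v * pivot_prob Ep En F u w"
proof -
  have "(\<lambda>C. incidence v C * incidence w C) = indicat_real {C. {v, w} \<subseteq> C}"
    by (auto simp: incidence_def indicator_def)
  then have "measure_pmf.expectation (pivot_cluster Ep En F U u)
        (\<lambda>C. incidence v C * incidence w C) =
      measure_pmf.prob (pivot_cluster Ep En F U u) {C. {v, w} \<subseteq> C}"
    by simp
  also have "\<dots> = (\<Prod>x\<in>{v, w} - {u}. join_prob Ep En F {u, x})"
    using assms by (subst prob_subset_pivot_cluster) auto
  also have "\<dots> = pivot_prob Ep En F u v * pivot_prob Ep En F u w"
    using assms by (auto simp: pivot_prob_def insert_Diff_if)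
  finally show ?thesis .
qed

section \<open>Excess of a pair and of a triangle\<close>

text \<open>
  For the pair \<open>{v, w}\<close>, the arguments \<open>a\<close> and \<open>b\<close> are the probabilities that \<open>v\<close> and \<open>w\<close> join the
  cluster; at \<open>a, b \<in> {0, 1}\<close> this is the realised excess of the pair.
\<close>
definition excess :: "bool \<Rightarrow> bool \<Rightarrow> real \<Rightarrow> real \<Rightarrow> real" where
  "excess pos cov a b =
     (if pos then a + b - 2 * (a * b) else a * b)
     - (if cov then 3 / 2 * (a + b - a * b) else 0)"

text \<open>For a triple \<open>u\<close>, \<open>v\<close>, \<open>w\<close>, the indices 1, 2, 3
  stand for the pairs \<open>vw\<close>, \<open>uw\<close>, \<open>uv\<close>, and the summands for
  the pivots \<open>u\<close>, \<open>v\<close>, \<open>w\<close>. Fixing the six booleans leaves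
  numerical inequalities. A bad triangle with exactly one covered pair gives the sum 0: with joining
  probability \<open>p\<close> for a covered positive pair it is \<open>2 * p - 1 / 2\<close>, and
  with \<open>q\<close> for a covered negative pair it is \<open>2 * (1 - q) - 1 / 2\<close>. These
  two cases force \<open>p \<le> 1 / 4\<close> and \<open>q \<ge> 3 / 4\<close>.\<close>

lemma excess_triangle:
  assumes "p3 \<Longrightarrow> p2 \<Longrightarrow> \<not> p1 \<Longrightarrow> c3 \<or> c2 \<or> c1"
    and "p3 \<Longrightarrow> p1 \<Longrightarrow> \<not> p2 \<Longrightarrow> c3 \<or> c2 \<or> c1"
    and "p2 \<Longrightarrow> p1 \<Longrightarrow> \<not> p3 \<Longrightarrow> c3 \<or> c2 \<or> c1"
  defines "j \<equiv> \<lambda>pos cov. if pos then if cov then 1 / 4 else 1 else if cov then 3 / 4 else 0"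
  shows "excess p1 c1 (j p3 c3) (j p2 c2) + excess p2 c2 (j p1 c1) (j p3 c3)
    + excess p3 c3 (j p2 c2) (j p1 c1) \<le> 0"
  using assms(1-3) unfolding j_def excess_def
  by (cases p1; cases p2; cases p3; cases c1; cases c2; cases c3)
     (simp_all only: if_True if_False simp_thms, simp_all)

text \<open>\<open>excess\<close> is linear in \<open>a\<close>, \<open>b\<close> and
  \<open>a * b\<close>, and distinct vertices join independently, so the expectation may be moved
  into the arguments.\<close>

lemma expectation_excess:
  assumes "finite U" and "u \<in> U" and "v \<in> U" and "w \<in> U" and "v \<noteq> w"
  shows "measure_pmf.expectation (pivot_cluster Ep En F U u)
           (\<lambda>C. excess s c (incidence v C) (incidence w C)) =
         excess s c (pivot_prob Ep En F u v) (pivot_prob Ep En F u w)"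
proof -
  note int = integrable_measure_pmf_finite[OF finite_set_pmf_pivot_cluster[OF assms(1,2)]]
  note [simp] = expectation_incidence[OF assms(1,2)] expectation_incidence_mult[OF assms]
  show ?thesis
    using assms by (cases s; cases c) (simp_all add: excess_def int)
qed

section \<open>Cost of removing one cluster\<close>

text \<open>All clusters in \<open>P\<close> avoid \<open>C\<close>, so a pair cut only after
  inserting \<open>C\<close> runs between \<open>C\<close> and \<open>U - C\<close>. The bound
  counts every such positive pair, while \<open>P\<close> may fail to cover \<open>U - C\<close>;
  hence an inequality.\<close>

lemma disagreements_insert_le:
  assumes "finite Ep" and "finite En" and "P \<subseteq> Pow (U - C)"
  shows "disagreements Ep En (insert C P) \<le> disagreements Ep En P
           + (card {e \<in> Ep. \<exists>v\<in>C. \<exists>w\<in>U - C. e = {v, w}} + card {e \<in> En. e \<subseteq> C})"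
proof -
  let ?cut = "\<lambda>P e. \<exists>A\<in>P. \<exists>B\<in>P. A \<noteq> B \<and> (\<exists>u\<in>A. \<exists>v\<in>B. e = {u, v})"
  let ?X = "{e \<in> Ep. \<exists>v\<in>C. \<exists>w\<in>U - C. e = {v, w}}"
  have "{e \<in> Ep. ?cut (insert C P) e} \<subseteq> {e \<in> Ep. ?cut P e} \<union> ?X"
  proof
    fix e assume "e \<in> {e \<in> Ep. ?cut (insert C P) e}"
    then obtain A B u v where *: "e \<in> Ep" "A \<in> insert C P" "B \<in> insert C P" "A \<noteq> B"
        "u \<in> A" "v \<in> B" "e = {u, v}"
      by blast
    consider "A = C" "B \<in> P" | "B = C" "A \<in> P" | "A \<in> P" "B \<in> P"
      using *(2-4) by blast
    then show "e \<in> {e \<in> Ep. ?cut P e} \<union> ?X"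
    proof cases
      case 1
      with *(5,6) assms(3) have "u \<in> C" "v \<in> U - C" by auto
      with *(7) have "\<exists>v\<in>C. \<exists>w\<in>U - C. e = {v, w}" by metis
      with *(1) show ?thesis by simp
    next
      case 2
      with *(5,6) assms(3) have "v \<in> C" "u \<in> U - C" by auto
      with *(7) have "\<exists>v\<in>C. \<exists>w\<in>U - C. e = {v, w}" by (metis insert_commute)
      with *(1) show ?thesis by simp
    next
      case 3
      with *(4-7) have "?cut P e" by metis
      with *(1) show ?thesis by simp
    qed
  qed
  then have "card {e \<in> Ep. ?cut (insert C P) e} \<le> card ({e \<in> Ep. ?cut P e} \<union> ?X)"
    using assms(1) by (intro card_mono) simp_all
  then have 1: "card {e \<in> Ep. ?cut (insert C P) e} \<le> card {e \<in> Ep. ?cut P e} + card ?X"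
    by (rule order_trans[OF _ card_Un_le])
  have "{e \<in> En. \<exists>A\<in>insert C P. e \<subseteq> A} = {e \<in> En. \<exists>A\<in>P. e \<subseteq> A} \<union> {e \<in> En. e \<subseteq> C}"
    by auto
  then have 2: "card {e \<in> En. \<exists>A\<in>insert C P. e \<subseteq> A} \<le>
      card {e \<in> En. \<exists>A\<in>P. e \<subseteq> A} + card {e \<in> En. e \<subseteq> C}"
    by (simp only: card_Un_le)
  show ?thesis
    unfolding disagreements_def using add_mono[OF 1 2] by (simp only: add.assoc add.left_commute add.commute)
qed

section \<open>Signs and coverage of pairs in the fixed graph\<close>

context
  fixes V :: "'a set" and Ep En F :: "'a set set"
  assumes graph: "complete_signed_graph V Ep En"
    and cover: "bad_triangle_cover V En F"
begin

lemma finite_V: "finite V"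
  and pairs_V: "Ep \<union> En = vertex_pairs V"
  and disjoint: "Ep \<inter> En = {}"
  and F_pairs: "F \<subseteq> vertex_pairs V"
  using graph cover by (auto simp: complete_signed_graph_def bad_triangle_cover_def)

lemma finite_Ep: "finite Ep" and finite_En: "finite En"
  using finite_vertex_pairs[OF finite_V] by (simp_all flip: pairs_V)

lemma pair_negative_iff:
  assumes "e \<in> vertex_pairs V"
  shows "e \<in> En \<longleftrightarrow> e \<notin> Ep"
  using assms pairs_V disjoint by blast

text \<open>On genuine pairs the sign is a single boolean, which brings the probability into the
  form of \<open>j\<close> in \<open>excess_triangle\<close>.\<close>

lemma join_prob_pair:
  assumes "e \<in> vertex_pairs V"
  shows "join_prob Ep En F e =
    (if e \<in> Ep then if e \<in> F then 1 / 4 else 1 else if e \<in> F then 3 / 4 else 0)"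
  using pair_negative_iff[OF assms] by (auto simp: join_prob_def)

lemma bad_triangle_covered:
  assumes "u \<in> V" "v \<in> V" "w \<in> V" and "u \<noteq> v" "u \<noteq> w" "v \<noteq> w"
    and "{u, v} \<in> Ep" "{u, w} \<in> Ep" "{v, w} \<notin> Ep"
  shows "{u, v} \<in> F \<or> {u, w} \<in> F \<or> {v, w} \<in> F"
proof -
  have sub: "e \<in> {{u, v}, {u, w}, {v, w}}" if e: "e \<in> vertex_pairs V" "e \<subseteq> {u, v, w}" for e
  proof -
    obtain a b where "e = {a, b}" "a \<noteq> b"
      using e(1) unfolding vertex_pairs_def card_2_iff by blast
    with e(2) show ?thesis by (auto simp: doubleton_eq_iff)
  qed
  have "{v, w} \<in> En"
    using assms pair_negative_iff doubleton_in_vertex_pairs by metis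
  then have "{e \<in> En. e \<subseteq> {u, v, w}} = {{v, w}}"
    using sub pairs_V disjoint assms(7,8) by blast
  then have "bad_triangle V En {u, v, w}"
    using assms by (auto simp: bad_triangle_def)
  then obtain e where "e \<in> F" "e \<subseteq> {u, v, w}"
    using cover by (auto simp: bad_triangle_cover_def)
  with sub F_pairs show ?thesis by blast
qed

section \<open>Excess summed over triples of vertices\<close>

text \<open>This is the expected excess of the pair \<open>{v, w}\<close> in a round with pivot
  \<open>u\<close>. The zero diagonal lets all three indices range independently.\<close>

definition pair_excess :: "'a \<Rightarrow> 'a \<Rightarrow> 'a \<Rightarrow> real" where
  "pair_excess u v w = (if v = w then 0 else
     excess ({v, w} \<in> Ep) ({v, w} \<in> F) (pivot_prob Ep En F u v) (pivot_prob Ep En F u w))"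

lemma pair_excess_commute: "pair_excess u v w = pair_excess u w v"
  by (simp add: pair_excess_def excess_def insert_commute mult.commute add.commute)

text \<open>With the pivot in the pair, \<open>a = 1\<close> and the pair surely leaves play. An
  uncovered pair is then treated according to its sign and costs 0; a covered one is a mistake with
  probability 3/4, against a payment of 3/2.\<close>

lemma pair_excess_pivot:
  assumes "u \<in> V" "w \<in> V"
  shows "pair_excess u u w \<le> 0"
proof (cases "u = w")
  case False
  then have "{u, w} \<in> vertex_pairs V"
    using assms by (intro doubleton_in_vertex_pairs)
  then show ?thesis
    using False by (auto simp: pair_excess_def excess_def pivot_prob_def join_prob_pair)
qed (simp add: pair_excess_def)

lemma pair_excess_triangle:
  assumes "u \<in> V" "v \<in> V" "w \<in> V"
  shows "pair_excess u v w + pair_excess v w u + pair_excess w u v \<le> 0"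
proof -
  consider "u = v" | "v = w" | "u = w" | "u \<noteq> v" "u \<noteq> w" "v \<noteq> w" by blast
  then show ?thesis
  proof cases
    case 1
    \<comment> \<open>When two vertices coincide, one summand vanishes on the diagonal and the other
      two are equal by symmetry, with the pivot in the pair.\<close>
    then show ?thesis
      using pair_excess_pivot[of u w] pair_excess_commute[of u w u] assms
      by (simp add: pair_excess_def)
  next
    case 2
    then show ?thesis
      using pair_excess_pivot[of v u] pair_excess_commute[of v u v] assms
      by (simp add: pair_excess_def)
  next
    case 3
    then show ?thesis
      using pair_excess_pivot[of u v] pair_excess_commute[of u v u] assms
      by (simp add: pair_excess_def)
  next
    case 4
    have pairs: "{u, v} \<in> vertex_pairs V" "{u, w} \<in> vertex_pairs V" "{v, w} \<in> vertex_pairs V"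
      using 4 assms by (auto intro: doubleton_in_vertex_pairs)
    have comm: "{v, u} = {u, v}" "{w, u} = {u, w}" "{w, v} = {v, w}"
      by auto
    have covered:
      "{u, v} \<in> Ep \<Longrightarrow> {u, w} \<in> Ep \<Longrightarrow> {v, w} \<notin> Ep \<Longrightarrow> {u, v} \<in> F \<or> {u, w} \<in> F \<or> {v, w} \<in> F"
      "{u, v} \<in> Ep \<Longrightarrow> {v, w} \<in> Ep \<Longrightarrow> {u, w} \<notin> Ep \<Longrightarrow> {u, v} \<in> F \<or> {u, w} \<in> F \<or> {v, w} \<in> F"
      "{u, w} \<in> Ep \<Longrightarrow> {v, w} \<in> Ep \<Longrightarrow> {u, v} \<notin> Ep \<Longrightarrow> {u, v} \<in> F \<or> {u, w} \<in> F \<or> {v, w} \<in> F"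
      using bad_triangle_covered[of u v w] bad_triangle_covered[of v u w]
        bad_triangle_covered[of w u v] 4 assms
      by (auto simp: comm)
    show ?thesis
      unfolding pair_excess_def pivot_prob_def comm
        join_prob_pair[OF pairs(1)] join_prob_pair[OF pairs(2)] join_prob_pair[OF pairs(3)]
      using excess_triangle[OF covered] 4 by simp
  qed
qed

text \<open>Rotating the summation variables does not change the total, so three times the total is
  a sum of nonpositive triangle groups.\<close>

lemma sum_pair_excess_le:
  assumes "U \<subseteq> V"
  shows "(\<Sum>u\<in>U. \<Sum>v\<in>U. \<Sum>w\<in>U. pair_excess u v w) \<le> 0"
proof -
  let ?S = "\<Sum>u\<in>U. \<Sum>v\<in>U. \<Sum>w\<in>U. pair_excess u v w"
  have 1: "(\<Sum>u\<in>U. \<Sum>v\<in>U. \<Sum>w\<in>U. pair_excess v w u) = ?S"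
    by (subst sum.swap) (rule sum.cong[OF refl], rule sum.swap)
  have 2: "(\<Sum>u\<in>U. \<Sum>v\<in>U. \<Sum>w\<in>U. pair_excess w u v) = ?S"
    by (rule trans[OF sum.cong[OF refl sum.swap] sum.swap])
  have "?S + ?S + ?S = (\<Sum>u\<in>U. \<Sum>v\<in>U. \<Sum>w\<in>U.
      pair_excess u v w + pair_excess v w u + pair_excess w u v)"
    using 1 2 by (simp add: sum.distrib)
  also have "\<dots> \<le> 0"
    using assms by (intro sum_nonpos pair_excess_triangle) auto
  finally show ?thesis by simp
qed

section \<open>Excess of one round\<close>

text \<open>New mistakes minus 3/2 times the pairs of \<open>F\<close> that leave play, written as a
  difference of potentials so that it telescopes over the rounds.\<close>

definition round_excess :: "'a set \<Rightarrow> 'a set \<Rightarrow> real" where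
  "round_excess U C =
     real (card {e \<in> Ep. \<exists>v\<in>C. \<exists>w\<in>U - C. e = {v, w}} + card {e \<in> En. e \<subseteq> C})
     + 3 / 2 * real (card {e \<in> F. e \<subseteq> U - C}) - 3 / 2 * real (card {e \<in> F. e \<subseteq> U})"

text \<open>At 0/1 values, \<open>a + b - 2 * (a * b)\<close> says that exactly one end lies in
  \<open>C\<close>, \<open>a * b\<close> that both do, and \<open>a + b - a * b\<close> that at
  least one does, that is, that the pair leaves play. The factor 2 comes from ordered pairs.\<close>

lemma round_excess_eq:
  assumes "U \<subseteq> V" and "C \<subseteq> U"
  shows "2 * round_excess U C = (\<Sum>v\<in>U. \<Sum>w\<in>U. if v = w then 0 else
     excess ({v, w} \<in> Ep) ({v, w} \<in> F) (incidence v C) (incidence w C))"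
proof -
  have finU: "finite U"
    using assms finite_V finite_subset by blast
  let ?M = "vertex_pairs U"
  have finM: "finite ?M" by (rule finite_vertex_pairs[OF finU])
  have count: "real (card {e \<in> A. Q e}) = (\<Sum>e\<in>?M. if e \<in> A \<and> Q e then 1 else 0)"
    if "\<And>e. e \<in> A \<Longrightarrow> Q e \<Longrightarrow> e \<in> ?M" for A Q
  proof -
    have "{e \<in> A. Q e} = {e \<in> ?M. e \<in> A \<and> Q e}"
      using that by auto
    then show ?thesis
      using finM by (simp add: sum.If_cases Int_def)
  qed
  have sub: "e \<in> ?M" if "e \<in> Ep \<or> e \<in> En \<or> e \<in> F" "e \<subseteq> U" for e
    using that pairs_V F_pairs by (auto simp: vertex_pairs_def)
  \<comment> \<open>\<open>g e\<close> is the contribution of the single pair \<open>e\<close>,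
    obtained by turning all four cardinalities into sums over the same index set.\<close>
  define g where "g e =
     (if e \<in> Ep \<and> (\<exists>v\<in>C. \<exists>w\<in>U - C. e = {v, w}) then 1 else 0)
     + (if e \<in> En \<and> e \<subseteq> C then 1 else 0)
     + 3 / 2 * (if e \<in> F \<and> e \<subseteq> U - C then 1 else 0)
     - 3 / 2 * (if e \<in> F \<and> e \<subseteq> U then 1 else (0::real))" for e
  have 1: "real (card {e \<in> Ep. \<exists>v\<in>C. \<exists>w\<in>U - C. e = {v, w}}) =
      (\<Sum>e\<in>?M. if e \<in> Ep \<and> (\<exists>v\<in>C. \<exists>w\<in>U - C. e = {v, w}) then 1 else 0)"
    using assms by (intro count sub) auto
  have 2: "real (card {e \<in> En. e \<subseteq> C}) = (\<Sum>e\<in>?M. if e \<in> En \<and> e \<subseteq> C then 1 else 0)"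
    using assms by (intro count sub) auto
  have 3: "real (card {e \<in> F. e \<subseteq> U - C}) = (\<Sum>e\<in>?M. if e \<in> F \<and> e \<subseteq> U - C then 1 else 0)"
    by (intro count sub) auto
  have 4: "real (card {e \<in> F. e \<subseteq> U}) = (\<Sum>e\<in>?M. if e \<in> F \<and> e \<subseteq> U then 1 else 0)"
    by (intro count sub) auto
  have "round_excess U C = (\<Sum>e\<in>?M. g e)"
    unfolding round_excess_def g_def of_nat_add 1 2 3 4
    by (simp only: sum.distrib sum_subtractf sum_distrib_left)
  then have "2 * round_excess U C = (\<Sum>v\<in>U. \<Sum>w\<in>U. if v = w then 0 else g {v, w})"
    using sum_ordered_pairs[OF finU] by simp
  also have "\<dots> = (\<Sum>v\<in>U. \<Sum>w\<in>U. if v = w then 0 else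
     excess ({v, w} \<in> Ep) ({v, w} \<in> F) (incidence v C) (incidence w C))"
  proof (intro sum.cong refl if_cong)
    fix v w assume vw: "v \<in> U" "w \<in> U" "\<not> v = w"
    then have "{v, w} \<in> vertex_pairs V"
      using assms by (intro doubleton_in_vertex_pairs) auto
    note neg = pair_negative_iff[OF this]
    have cut: "(\<exists>x\<in>C. \<exists>y\<in>U - C. {v, w} = {x, y}) \<longleftrightarrow> (v \<in> C) \<noteq> (w \<in> C)"
      using vw by (auto simp: doubleton_eq_iff)
    show "g {v, w} = excess ({v, w} \<in> Ep) ({v, w} \<in> F) (incidence v C) (incidence w C)"
      unfolding g_def cut neg using vw
      by (cases "v \<in> C"; cases "w \<in> C") (auto simp: excess_def incidence_def)
  qed
  finally show ?thesis .
qed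

text \<open>By linearity, each pivot's expectation is half a double sum of
  \<open>pair_excess\<close>; summing over pivots yields the triple sum. A single pivot may have
  positive expected excess, so only the sum is bounded.\<close>

lemma sum_expectation_round_excess_le:
  assumes "U \<subseteq> V"
  shows "(\<Sum>u\<in>U. measure_pmf.expectation (pivot_cluster Ep En F U u) (round_excess U)) \<le> 0"
proof -
  have finU: "finite U"
    using assms finite_V finite_subset by blast
  have "2 * measure_pmf.expectation (pivot_cluster Ep En F U u) (round_excess U) =
      (\<Sum>v\<in>U. \<Sum>w\<in>U. pair_excess u v w)" if u: "u \<in> U" for u
  proof -
    let ?D = "pivot_cluster Ep En F U u"
    note int = integrable_measure_pmf_finite[OF finite_set_pmf_pivot_cluster[OF finU u]]
    have "2 * measure_pmf.expectation ?D (round_excess U) =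
        measure_pmf.expectation ?D (\<lambda>C. 2 * round_excess U C)"
      by simp
    also have "\<dots> = measure_pmf.expectation ?D (\<lambda>C. \<Sum>v\<in>U. \<Sum>w\<in>U. if v = w then 0 else
        excess ({v, w} \<in> Ep) ({v, w} \<in> F) (incidence v C) (incidence w C))"
      using round_excess_eq[OF assms] set_pmf_pivot_cluster(2)[OF u]
      by (intro integral_cong_AE) (auto simp: AE_measure_pmf_iff)
    also have "\<dots> = (\<Sum>v\<in>U. \<Sum>w\<in>U. measure_pmf.expectation ?D (\<lambda>C. if v = w then 0 else
        excess ({v, w} \<in> Ep) ({v, w} \<in> F) (incidence v C) (incidence w C)))"
      by (simp add: Bochner_Integration.integral_sum int)
    also have "\<dots> = (\<Sum>v\<in>U. \<Sum>w\<in>U. pair_excess u v w)"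
      using expectation_excess[OF finU u]
      by (intro sum.cong refl) (auto simp: pair_excess_def)
    finally show ?thesis .
  qed
  then have "2 * (\<Sum>u\<in>U. measure_pmf.expectation (pivot_cluster Ep En F U u) (round_excess U)) =
      (\<Sum>u\<in>U. \<Sum>v\<in>U. \<Sum>w\<in>U. pair_excess u v w)"
    by (simp add: sum_distrib_left)
  with sum_pair_excess_le[OF assms] show ?thesis by linarith
qed

section \<open>Induction over the rounds\<close>

lemma expectation_disagreements_le:
  assumes "U \<subseteq> V"
  shows "measure_pmf.expectation (pivot_clustering Ep En F U)
           (\<lambda>P. real (disagreements Ep En P)) \<le> 3 / 2 * real (card {e \<in> F. e \<subseteq> U})"
  using assms
proof (induction "card U" arbitrary: U rule: less_induct)
  case less
  have finU: "finite U"
    using less.prems finite_V finite_subset by blast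
  let ?cost = "\<lambda>P. real (disagreements Ep En P)"
  let ?B = "\<lambda>U. 3 / 2 * real (card {e \<in> F. e \<subseteq> U})"
  show ?case
  proof (cases "U = {}")
    case True
    then show ?thesis
      by (simp add: pivot_clustering.simps[of _ _ _ "{}"] disagreements_def)
  next
    case False
    let ?D = "pivot_cluster Ep En F U"
    let ?R = "\<lambda>C. map_pmf (insert C) (pivot_clustering Ep En F (U - C))"
    \<comment> \<open>Conditioned on the first cluster \<open>C\<close>, the induction hypothesis
      bounds the later rounds by the potential of \<open>U - C\<close>; adding the cost
      \<open>s\<close> of this round gives the excess plus the potential of
      \<open>U\<close>.\<close>
    have rest: "measure_pmf.expectation (?R C) ?cost \<le> round_excess U C + ?B U"
      if u: "u \<in> U" and C: "C \<in> set_pmf (?D u)" for u C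
    proof -
      have "card (U - C) < card U"
        using set_pmf_pivot_cluster[OF u C] u finU by (intro psubset_card_mono) auto
      then have IH: "measure_pmf.expectation (pivot_clustering Ep En F (U - C)) ?cost \<le> ?B (U - C)"
        using less.hyps less.prems by blast
      have fin: "finite (set_pmf (pivot_clustering Ep En F (U - C)))"
        using finU by (intro finite_set_pmf_pivot_clustering) auto
      define s where "s =
        real (card {e \<in> Ep. \<exists>v\<in>C. \<exists>w\<in>U - C. e = {v, w}} + card {e \<in> En. e \<subseteq> C})"
      have "measure_pmf.expectation (?R C) ?cost =
          measure_pmf.expectation (pivot_clustering Ep En F (U - C)) (\<lambda>P. ?cost (insert C P))"
        by simp
      also have "\<dots> \<le> measure_pmf.expectation (pivot_clustering Ep En F (U - C))
          (\<lambda>P. ?cost P + s)"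
      proof (rule expectation_mono_finite[OF fin])
        fix P assume "P \<in> set_pmf (pivot_clustering Ep En F (U - C))"
        then have "P \<subseteq> Pow (U - C)"
          using finU by (intro set_pmf_pivot_clustering) auto
        from disagreements_insert_le[OF finite_Ep finite_En this]
        show "?cost (insert C P) \<le> ?cost P + s"
          unfolding s_def of_nat_add[symmetric] of_nat_le_iff .
      qed
      also have "\<dots> = measure_pmf.expectation (pivot_clustering Ep En F (U - C)) ?cost + s"
        by (subst Bochner_Integration.integral_add)
           (auto intro: integrable_measure_pmf_finite[OF fin])
      also have "\<dots> \<le> ?B (U - C) + s"
        using IH by simp
      also have "\<dots> = round_excess U C + ?B U"
        by (simp add: round_excess_def s_def)
      finally show ?thesis .
    qed
    have finD: "finite (set_pmf (?D u))" if "u \<in> U" for u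
      using finite_set_pmf_pivot_cluster[OF finU that] .
    have finR: "finite (set_pmf (?R C))" for C
      using finU by (simp add: finite_set_pmf_pivot_clustering)
    have "measure_pmf.expectation (pivot_clustering Ep En F U) ?cost =
        measure_pmf.expectation (pmf_of_set U)
          (\<lambda>u. measure_pmf.expectation (bind_pmf (?D u) ?R) ?cost)"
      using False finU finD finR
      unfolding pivot_clustering_step[OF finU False]
      by (intro expectation_bind_pmf_finite) auto
    also have "\<dots> \<le> measure_pmf.expectation (pmf_of_set U)
        (\<lambda>u. measure_pmf.expectation (?D u) (round_excess U) + ?B U)"
    proof (rule expectation_mono_finite)
      fix u assume "u \<in> set_pmf (pmf_of_set U)"
      then have u: "u \<in> U"
        using False finU by simp
      have "measure_pmf.expectation (bind_pmf (?D u) ?R) ?cost =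
          measure_pmf.expectation (?D u) (\<lambda>C. measure_pmf.expectation (?R C) ?cost)"
        using finD[OF u] finR by (intro expectation_bind_pmf_finite)
      also have "\<dots> \<le> measure_pmf.expectation (?D u) (\<lambda>C. round_excess U C + ?B U)"
        using finD[OF u] rest[OF u] by (rule expectation_mono_finite)
      also have "\<dots> = measure_pmf.expectation (?D u) (round_excess U) + ?B U"
        by (subst Bochner_Integration.integral_add)
           (auto intro: integrable_measure_pmf_finite[OF finD[OF u]])
      finally show "measure_pmf.expectation (bind_pmf (?D u) ?R) ?cost \<le>
          measure_pmf.expectation (?D u) (round_excess U) + ?B U" .
    qed (use False finU in simp)
    \<comment> \<open>Uniformity of the pivot turns the mean excess into the nonpositive sum over
      all pivots, divided by \<open>card U\<close>.\<close>
    also have "\<dots> = (\<Sum>u\<in>U. measure_pmf.expectation (?D u) (round_excess U)) / card U + ?B U"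
      using False finU by (simp add: integral_pmf_of_set sum.distrib add_divide_distrib)
    also have "\<dots> \<le> ?B U"
      using sum_expectation_round_excess_le[OF less.prems] by (simp add: divide_nonpos_nonneg)
    finally show ?thesis .
  qed
qed

end

theorem theorem8:
  fixes V :: "'a set" and Ep En F :: "'a set set"
  assumes "complete_signed_graph V Ep En"
    and "bad_triangle_cover V En F"
  shows "measure_pmf.expectation (pivot_clustering Ep En F V)
           (\<lambda>P. real (disagreements Ep En P)) \<le> 3 / 2 * real (card F)"
proof -
  have "{e \<in> F. e \<subseteq> V} = F"
    using assms(2) by (auto simp: bad_triangle_cover_def vertex_pairs_def)
  with expectation_disagreements_le[OF assms order_refl] show ?thesis by simp
qed

end
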